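(* Let $d\ge 2$ and let $A=[A(i_1,\ldots,i_d)]$ be a nonzero tensor. Suppose there is a tensor $X$ in tensor train format with ranks $r_1,\ldots,r_{d-1}$ such that $|A-X|\le E_C$ and $\|A-X\|\le E_F$. For every $k=1,\ldots,d-1$ let $[\mathcal I^{\leq k},\mathcal I^{>k}]=\mathrm{maxvol}\,A^{\{k\}}$, with $r_k$ rows and $r_k$ columns, and suppose that $A_k=[A(\mathcal I^{\leq k},\mathcal I^{>k})]$ is nonsingular. Let $\tilde A$ be the tensor train cross interpolation of $A$ on these sets. Put $r=\max_k r_k$, $\kappa_k=r_k\,|A|\,|A_k^{-1}|$ and $\kappa=\max_k\kappa_k$. Then: (i) if $E_F$ is small enough that $(2r+\kappa r+1)^{\lceil\log_2 d\rceil}(r+1)E_F<|A|$, then $$|A-\tilde A|\le (2r+\kappa r+1)^{\lceil\log_2 d\rceil}(r+1)\,E_F;$$ (ii) if $E_C$ is small enough that $(2r+\kappa r+1)^{\lceil\log_2 d\rceil}(r+1)^2E_C<|A|$, then $$|A-\tilde A|\le (2r+\kappa r+1)^{\lceil\log_2 d\rceil}(r+1)^2\,E_C.$$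
   Context: Tensors are real or complex arrays with indices $i_k\in\{1,\ldots,n_k\}$, $k=1,\ldots,d$. For a tensor or matrix, $|A|=\max|A(i_1,\ldots,i_d)|$ (maximum entry in modulus, Chebyshev norm) and $\|A\|=\big(\sum|A(i_1,\ldots,i_d)|^2\big)^{1/2}$ (Frobenius norm); in particular $|A_k^{-1}|$ is the maximum modulus of an entry of $A_k^{-1}$. Multi-indices: $i_{\leq k}=(i_1,\ldots,i_k)$, $i_{>k}=(i_{k+1},\ldots,i_d)$. The $k$-th unfolding $A^{\{k\}}$ is the $(n_1\cdots n_k)\times(n_{k+1}\cdots n_d)$ matrix with entries $A^{\{k\}}(i_{\leq k},i_{>k})=A(i_1,\ldots,i_d)$. $X$ is in tensor train (TT) format with ranks $r_1,\ldots,r_{d-1}$ (and $r_0=r_d=1$) if $X(i_1,\ldots,i_d)=\sum_{s_1,\ldots,s_{d-1}}\prod_{k=1}^d X^{(k)}(s_{k-1},i_k,s_k)$, with $s_k$ running over $1,\ldots,r_k$. Interpolation sets: $\mathcal I^{\leq k}=\{\mathcal I^{\leq k}_1,\ldots,\mathcal I^{\leq k}_{r_k}\}$ is a set of $r_k$ distinct left multi-indices $i_{\leq k}$ and $\mathcal I^{>k}=\{\mathcal I^{>k}_1,\ldots,\mathcal I^{>k}_{r_k}\}$ a set of $r_k$ distinct right multi-indices $i_{>k}$; $\mathcal I^{\leq 0}$ and $\mathcal I^{>d}$ are empty (no index restriction). $A_k=[A(\mathcal I^{\leq k}_{s},\mathcal I^{>k}_{t})]_{s,t=1}^{r_k}$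 and $B^{[k]}=A_k^{-1}$. For a matrix $M$ and a prescribed size $r$, $[\mathcal I,\mathcal J]=\mathrm{maxvol}\,M$ means that $\mathcal I$ is a set of $r$ rows and $\mathcal J$ a set of $r$ columns for which $|\det M(\mathcal I,\mathcal J)|$ is maximal over all $r\times r$ submatrices of $M$. The tensor train cross interpolation on these sets is $$\tilde A(i_1,\ldots,i_d)=\sum_{s_1,\ldots,s_{d-1}}\sum_{t_1,\ldots,t_{d-1}}A(i_1,\mathcal I^{>1}_{t_1})\prod_{k=1}^{d-1}B^{[k]}_{t_k,s_k}\,A(\mathcal I^{\leq k}_{s_k},i_{k+1},\mathcal I^{>k+1}_{t_{k+1}}),$$ where $s_k,t_k$ run over $1,\ldots,r_k$ and for $k=d-1$ the last factor is $A(\mathcal I^{\leq d-1}_{s_{d-1}},i_d)$. *)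

theory Defs
  imports
    Complex_Main
    "HOL-Library.FuncSet"
    "Jordan_Normal_Form.Determinant"
    "Jordan_Normal_Form.Gauss_Jordan_Elimination"
begin

text \<open>
  A tensor with mode sizes \<open>ns = [n\<^sub>1, \<dots>, n\<^sub>d]\<close> is a function on multi-indices; only its values
  on \<open>multi_indices ns\<close> matter. A multi-index is a list, so that \<open>i\<^sub>k\<close> is \<open>i ! (k - 1)\<close>,
  the left part \<open>i\<^sub>\<le>\<^sub>k\<close> ranges over \<open>multi_indices (take k ns)\<close>, the right part \<open>i\<^sub>>\<^sub>k\<close> over
  \<open>multi_indices (drop k ns)\<close>, and joining the two parts is list append.
  The entries are from an arbitrary \<open>real_normed_field\<close>, of which \<open>real\<close> and \<open>complex\<close>
  are the instances of interest.
\<close>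

type_synonym 'a tensor = "nat list \<Rightarrow> 'a"

definition multi_indices :: "nat list \<Rightarrow> nat list set" where
  "multi_indices ns = {i. list_all2 (\<lambda>j n. j \<in> {1..n}) i ns}"

definition chebyshev_norm :: "nat list \<Rightarrow> 'a::real_normed_field tensor \<Rightarrow> real" where
  "chebyshev_norm ns A = Max ((\<lambda>i. norm (A i)) ` multi_indices ns)"

definition frobenius_norm :: "nat list \<Rightarrow> 'a::real_normed_field tensor \<Rightarrow> real" where
  "frobenius_norm ns A = sqrt (\<Sum>i\<in>multi_indices ns. (norm (A i))\<^sup>2)"

definition mat_chebyshev_norm :: "'a::real_normed_field mat \<Rightarrow> real" where
  "mat_chebyshev_norm M = Max (norm ` elements_mat M)"

text \<open>
  The unfolding is a matrix whose rows and columns are labelled by multi-indices. Since neither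
  determinants of submatrices (in modulus) nor the interpolation depend on an enumeration of the
  labels, it is kept as a function of two labels.
\<close>

definition unfolding_mat :: "'a tensor \<Rightarrow> nat list \<Rightarrow> nat list \<Rightarrow> 'a" where
  "unfolding_mat A = (\<lambda>i j. A (i @ j))"

text \<open>A set of \<open>r\<close> rows or columns, in a chosen order.\<close>

definition index_selection :: "'i set \<Rightarrow> nat \<Rightarrow> 'i list \<Rightarrow> bool" where
  "index_selection S r I \<longleftrightarrow> length I = r \<and> distinct I \<and> set I \<subseteq> S"

definition sub_mat :: "('i \<Rightarrow> 'j \<Rightarrow> 'a) \<Rightarrow> 'i list \<Rightarrow> 'j list \<Rightarrow> 'a mat" where
  "sub_mat M I J = mat (length I) (length J) (\<lambda>(s, t). M (I ! s) (J ! t))"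

definition is_maxvol ::
  "'i set \<Rightarrow> 'j set \<Rightarrow> ('i \<Rightarrow> 'j \<Rightarrow> 'a::real_normed_field) \<Rightarrow> nat \<Rightarrow> 'i list \<Rightarrow> 'j list \<Rightarrow> bool" where
  "is_maxvol R C M r I J \<longleftrightarrow>
     index_selection R r I \<and> index_selection C r J \<and>
     (\<forall>I' J'. index_selection R r I' \<and> index_selection C r J' \<longrightarrow>
        norm (det (sub_mat M I' J')) \<le> norm (det (sub_mat M I J)))"

text \<open>
  Summation indices \<open>s\<^sub>k\<close> run over \<open>{..<r k}\<close>, so that they can be used directly
  as positions in lists and matrices.
\<close>

definition has_tt_format :: "nat list \<Rightarrow> (nat \<Rightarrow> nat) \<Rightarrow> 'a::real_normed_field tensor \<Rightarrow> bool" where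
  "has_tt_format ns r X \<longleftrightarrow> r 0 = 1 \<and> r (length ns) = 1 \<and>
     (\<exists>G :: nat \<Rightarrow> nat \<Rightarrow> nat \<Rightarrow> nat \<Rightarrow> 'a. \<forall>i\<in>multi_indices ns.
        X i = (\<Sum>s\<in>Pi\<^sub>E {0..length ns} (\<lambda>k. {..<r k}).
                 \<Prod>k=1..length ns. G k (s (k - 1)) (i ! (k - 1)) (s k)))"

text \<open>The matrix \<open>A\<^sub>k\<close>; \<open>I k\<close> and \<open>J k\<close> list the left and right interpolation sets.\<close>

definition cross_mat ::
  "'a tensor \<Rightarrow> (nat \<Rightarrow> nat list list) \<Rightarrow> (nat \<Rightarrow> nat list list) \<Rightarrow> nat \<Rightarrow> 'a mat" where
  "cross_mat A I J k = sub_mat (unfolding_mat A) (I k) (J k)"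

text \<open>Only meaningful for an invertible argument.\<close>

definition inv_mat :: "'a::field mat \<Rightarrow> 'a mat" where
  "inv_mat M = the (mat_inverse M)"

text \<open>
  The last factor, \<open>k = d - 1\<close>, has no right interpolation index, hence the empty list there.
  The list position \<open>i ! k\<close> is the index \<open>i\<^bsub>k+1\<^esub>\<close>.
\<close>

definition tt_cross ::
  "nat \<Rightarrow> (nat \<Rightarrow> nat) \<Rightarrow> (nat \<Rightarrow> nat list list) \<Rightarrow> (nat \<Rightarrow> nat list list) \<Rightarrow>
   'a::real_normed_field tensor \<Rightarrow> 'a tensor" where
  "tt_cross d r I J A = (\<lambda>i.
     \<Sum>s\<in>Pi\<^sub>E {1..d - 1} (\<lambda>k. {..<r k}). \<Sum>t\<in>Pi\<^sub>E {1..d - 1} (\<lambda>k. {..<r k}).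
       A ([i ! 0] @ J 1 ! t 1) *
       (\<Prod>k=1..d - 1. inv_mat (cross_mat A I J k) $$ (t k, s k) *
          A (I k ! s k @ [i ! k] @ (if k = d - 1 then [] else J (k + 1) ! t (k + 1)))))"

end

theory Submission
  imports Defs "HOL-Analysis.L2_Norm"
begin

text \<open>
  For one unfolding, the error of the cross interpolation at an entry is the quotient of the
  bordered \<open>(r + 1) \<times> (r + 1)\<close> minor \<open>M'\<close> by \<open>det A\<^sub>k\<close>. The low-rank matrix \<open>X\<close>, restricted to the
  bordered rows and columns, has a kernel vector \<open>v\<close>, so that \<open>det M' \<cdot> v = adj M' (M' - X) v\<close>; the
  entries of \<open>adj M'\<close> are \<open>r \<times> r\<close> minors, hence at most \<open>\<bar>det A\<^sub>k\<bar>\<close> in modulus by maximality of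
  the volume. This gives the bounds \<open>(r + 1)\<^sup>2 E\<^sub>C\<close> and, by Cauchy-Schwarz, \<open>(r + 1) E\<^sub>F\<close>.

  The tensor train cross interpolation is a chain that can be split at any cut \<open>k\<close> into two shorter
  chains joined by \<open>A\<^sub>k\<^sup>-\<^sup>1\<close>. If both halves are accurate to \<open>\<epsilon> \<le> \<bar>A\<bar>\<close>, replacing them in the cross
  interpolation of the unfolding costs at most \<open>(2r + \<kappa>r) \<epsilon>\<close>, since the interpolation coefficients
  are bounded by 1 in modulus (Cramer's rule and maximality of the volume). Halving the chain
  \<open>\<lceil>log\<^sub>2 d\<rceil>\<close> times yields the theorem.
\<close>

section \<open>Submatrices, their determinants and maximal volume\<close>

lemma sub_mat_carrier: "sub_mat M I J \<in> carrier_mat (length I) (length J)"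
  by (simp add: sub_mat_def)

lemma transpose_sub_mat: "transpose_mat (sub_mat M I J) = sub_mat (\<lambda>j i. M i j) J I"
  by (rule eq_matI) (auto simp: sub_mat_def)

lemma det_sub_mat_flip:
  assumes "length I = length J"
  shows "det (sub_mat (\<lambda>j i. M i j) J I) = det (sub_mat M I J)"
  using det_transpose[of "sub_mat M I J" "length J"] assms
    sub_mat_carrier[of M I J] by (simp add: transpose_sub_mat)

lemma is_maxvol_flip:
  assumes "is_maxvol R C M r I J"
  shows "is_maxvol C R (\<lambda>j i. M i j) r J I"
  using assms unfolding is_maxvol_def index_selection_def by (metis det_sub_mat_flip)

lemma mult_sub_mat_vec:
  assumes "s < length I"
  shows "(sub_mat M I J *\<^sub>v vec (length J) x) $ s = (\<Sum>t<length J. M (I ! s) (J ! t) * x t)"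
  using assms by (simp add: sub_mat_def scalar_prod_def lessThan_atLeast0)

text \<open>Cramer's rule: the new column is the submatrix applied to \<open>x\<close>, and putting
  such a product in place of column \<open>k\<close> multiplies the determinant by
  \<open>x k\<close>.\<close>

lemma det_sub_mat_update_col:
  fixes M :: "'i \<Rightarrow> 'j \<Rightarrow> 'a::field"
  assumes "length I = length J" "k < length J"
    and "\<And>s. s < length I \<Longrightarrow> M (I ! s) j = (\<Sum>t<length J. M (I ! s) (J ! t) * x t)"
  shows "det (sub_mat M I (J[k := j])) = x k * det (sub_mat M I J)"
proof -
  let ?A = "sub_mat M I J" and ?x = "vec (length J) x"
  have "replace_col ?A (?A *\<^sub>v ?x) k = sub_mat M I (J[k := j])"
  proof (rule eq_matI)
    fix a b assume ab: "a < dim_row (sub_mat M I (J[k := j]))" "b < dim_col (sub_mat M I (J[k := j]))"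
    then have "(?A *\<^sub>v ?x) $ a = M (I ! a) j"
      using assms(3)[of a] mult_sub_mat_vec[of a I M J x] by (simp add: sub_mat_def)
    with ab assms(2) show "replace_col ?A (?A *\<^sub>v ?x) k $$ (a, b) = sub_mat M I (J[k := j]) $$ (a, b)"
      by (auto simp: replace_col_def sub_mat_def nth_list_update)
  qed (auto simp: replace_col_def sub_mat_def)
  moreover have "det (replace_col ?A (?A *\<^sub>v ?x) k) = ?x $ k * det ?A"
    by (rule cramer_lemma_mat[of _ "length J"]) (use assms in \<open>auto simp: sub_mat_def\<close>)
  ultimately show ?thesis using assms(2) by simp
qed

lemma det_sub_mat_eq_0_cols:
  fixes M :: "'i \<Rightarrow> 'j \<Rightarrow> 'a::field"
  assumes "length I = length J" "\<not> distinct J"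
  shows "det (sub_mat M I J) = 0"
proof -
  obtain a b where "a < length J" "b < length J" "a \<noteq> b" "J ! a = J ! b"
    using assms(2) by (auto simp: distinct_conv_nth)
  then show ?thesis
    by (intro det_identical_columns[of _ "length J" a b])
       (use assms in \<open>auto simp: sub_mat_def intro!: eq_vecI\<close>)
qed

lemma det_sub_mat_eq_0_rows:
  fixes M :: "'i \<Rightarrow> 'j \<Rightarrow> 'a::field"
  assumes "length I = length J" "\<not> distinct I"
  shows "det (sub_mat M I J) = 0"
  using det_sub_mat_eq_0_cols[of J I "\<lambda>j i. M i j"] det_sub_mat_flip[of I J M] assms by simp

text \<open>A repeated row or column makes the determinant vanish, so the comparison in
  \<open>is_maxvol\<close> extends from distinct selections to arbitrary lists. Exchanging or
  bordering indices can produce such repetitions.\<close>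

lemma is_maxvol_le:
  assumes "is_maxvol R C M r I J" "length I' = r" "length J' = r" "set I' \<subseteq> R" "set J' \<subseteq> C"
  shows "norm (det (sub_mat M I' J')) \<le> norm (det (sub_mat M I J))"
proof (cases "distinct I' \<and> distinct J'")
  case True
  then show ?thesis using assms by (auto simp: is_maxvol_def index_selection_def)
next
  case False
  then show ?thesis
    using assms det_sub_mat_eq_0_cols[of I' J' M] det_sub_mat_eq_0_rows[of I' J' M] by auto
qed

lemma is_maxvol_lengths:
  assumes "is_maxvol R C M r I J"
  shows "length I = r" "length J = r" "set I \<subseteq> R" "set J \<subseteq> C"
  using assms by (auto simp: is_maxvol_def index_selection_def)

text \<open>The sums solve the linear system that expresses column \<open>j\<close>, on the rows
  \<open>I\<close>, through the columns \<open>J\<close>. By Cramer's rule each of them is the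
  quotient of the minor with column \<open>t\<close> exchanged for \<open>j\<close> by the maximal
  minor.\<close>

lemma maxvol_coeff_col:
  fixes M :: "'i \<Rightarrow> 'j \<Rightarrow> 'a::real_normed_field"
  assumes mv: "is_maxvol R C M r I J" and nz: "det (sub_mat M I J) \<noteq> 0"
    and inv: "\<And>s s'. s < r \<Longrightarrow> s' < r \<Longrightarrow>
        (\<Sum>t<r. M (I ! s) (J ! t) * B t s') = (if s = s' then 1 else 0)"
    and j: "j \<in> C" and t: "t < r"
  shows "norm (\<Sum>s<r. B t s * M (I ! s) j) \<le> 1"
proof -
  note len = is_maxvol_lengths[OF mv]
  define x where "x t = (\<Sum>s<r. B t s * M (I ! s) j)" for t
  have "M (I ! s) j = (\<Sum>t<r. M (I ! s) (J ! t) * x t)" if "s < r" for s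
  proof -
    have "(\<Sum>t<r. M (I ! s) (J ! t) * x t)
        = (\<Sum>s'<r. (\<Sum>t<r. M (I ! s) (J ! t) * B t s') * M (I ! s') j)"
      unfolding x_def sum_distrib_left sum_distrib_right
      by (subst sum.swap) (simp add: mult.assoc)
    also have "\<dots> = (\<Sum>s'<r. if s = s' then M (I ! s') j else 0)"
      by (intro sum.cong) (use that inv in auto)
    finally show ?thesis using that by simp
  qed
  then have "det (sub_mat M I (J[t := j])) = x t * det (sub_mat M I J)"
    by (intro det_sub_mat_update_col) (use len t in auto)
  moreover have "norm (det (sub_mat M I (J[t := j]))) \<le> norm (det (sub_mat M I J))"
    by (intro is_maxvol_le[OF mv])
       (use len j set_update_subset_insert[of J t j] in auto)
  ultimately have "norm (x t) * norm (det (sub_mat M I J)) \<le> 1 * norm (det (sub_mat M I J))"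
    by (simp add: norm_mult)
  then show ?thesis using nz unfolding x_def by (simp only: mult_le_cancel_right) simp
qed

text \<open>The transposed case, in which \<open>B\<close> enters as a left inverse instead of a
  right inverse.\<close>

lemma maxvol_coeff_row:
  fixes M :: "'i \<Rightarrow> 'j \<Rightarrow> 'a::real_normed_field"
  assumes mv: "is_maxvol R C M r I J" and nz: "det (sub_mat M I J) \<noteq> 0"
    and inv: "\<And>t t'. t < r \<Longrightarrow> t' < r \<Longrightarrow>
        (\<Sum>s<r. B t s * M (I ! s) (J ! t')) = (if t = t' then 1 else 0)"
    and i: "i \<in> R" and s: "s < r"
  shows "norm (\<Sum>t<r. M i (J ! t) * B t s) \<le> 1"
proof -
  note len = is_maxvol_lengths[OF mv]
  have "norm (\<Sum>t<r. B t s * M i (J ! t)) \<le> 1"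
    by (rule maxvol_coeff_col[OF is_maxvol_flip[OF mv], of "\<lambda>s t. B t s"])
       (use len nz det_sub_mat_flip[of I J M] inv i s in \<open>auto simp: mult.commute\<close>)
  then show ?thesis by (simp add: mult.commute)
qed

lemma mat_delete_sub_mat:
  assumes "p < length I" "q < length J"
  shows "mat_delete (sub_mat M I J) p q
    = sub_mat M (take p I @ drop (Suc p) I) (take q J @ drop (Suc q) J)"
  by (rule eq_matI) (use assms in \<open>auto simp: mat_delete_def sub_mat_def nth_append\<close>)

text \<open>The Schur complement formula. Subtracting from the last column the combination of the
  others that interpolates it leaves only the corner entry, and this entry is the interpolation
  error at \<open>i\<close>, \<open>j\<close>.\<close>

lemma det_sub_mat_bordered:
  fixes M :: "'i \<Rightarrow> 'j \<Rightarrow> 'a::field"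
  assumes len: "length I = r" "length J = r"
    and inv: "\<And>s s'. s < r \<Longrightarrow> s' < r \<Longrightarrow>
        (\<Sum>t<r. M (I ! s) (J ! t) * B t s') = (if s = s' then 1 else 0)"
  shows "det (sub_mat M (I @ [i]) (J @ [j]))
    = (M i j - (\<Sum>t<r. \<Sum>s<r. M i (J ! t) * B t s * M (I ! s) j)) * det (sub_mat M I J)"
proof -
  define x where "x t = (\<Sum>s<r. B t s * M (I ! s) j)" for t
  define y where "y = M i j - (\<Sum>t<r. \<Sum>s<r. M i (J ! t) * B t s * M (I ! s) j)"
  let ?A = "sub_mat M (I @ [i]) (J @ [j])"
  \<comment> \<open>Weight 1 on the last column keeps the determinant when that column is replaced
    by \<open>?A *\<^sub>v ?x\<close>; the weights \<open>- x t\<close> clear its first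
    \<open>r\<close> entries.\<close>
  let ?x = "vec (Suc r) (\<lambda>t. if t < r then - x t else 1)"
  let ?R = "replace_col ?A (?A *\<^sub>v ?x) r"
  have A: "?A \<in> carrier_mat (Suc r) (Suc r)" using sub_mat_carrier[of M "I @ [i]" "J @ [j]"] len by simp
  have Ax: "(?A *\<^sub>v ?x) $ a = (if a = r then y else 0)" if "a < Suc r" for a
  proof -
    have "(?A *\<^sub>v ?x) $ a = M ((I @ [i]) ! a) j - (\<Sum>t<r. M ((I @ [i]) ! a) (J ! t) * x t)"
    proof -
      have "(?A *\<^sub>v ?x) $ a = (\<Sum>t<Suc r. M ((I @ [i]) ! a) ((J @ [j]) ! t) * (if t < r then - x t else 1))"
        using mult_sub_mat_vec[of a "I @ [i]" M "J @ [j]" "\<lambda>t. if t < r then - x t else 1"] that len by simp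
      also have "\<dots> = M ((I @ [i]) ! a) j - (\<Sum>t<r. M ((I @ [i]) ! a) (J ! t) * x t)"
        using len by (simp add: nth_append sum_negf)
      finally show ?thesis .
    qed
    also have "\<dots> = (if a = r then y else 0)"
    proof (cases "a = r")
      case True
      then show ?thesis using len
        by (simp add: nth_append y_def x_def sum_distrib_left mult.assoc)
    next
      case False
      then have a: "a < r" using that by simp
      have "(\<Sum>t<r. M (I ! a) (J ! t) * x t)
        = (\<Sum>s'<r. (\<Sum>t<r. M (I ! a) (J ! t) * B t s') * M (I ! s') j)"
        unfolding x_def sum_distrib_left sum_distrib_right
        by (subst sum.swap) (simp add: mult.assoc)
      also have "\<dots> = (\<Sum>s'<r. if a = s' then M (I ! s') j else 0)"
        by (intro sum.cong) (use a inv in auto)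
      also have "\<dots> = M (I ! a) j" using a by simp
      finally show ?thesis using a len by (simp add: nth_append)
    qed
    finally show ?thesis .
  qed
  have "det ?R = ?x $ r * det ?A"
    by (rule cramer_lemma_mat[OF A]) auto
  moreover have "det ?R = y * det (sub_mat M I J)"
  proof -
    have R: "?R \<in> carrier_mat (Suc r) (Suc r)" using A by (auto simp: replace_col_def)
    have "mat_delete ?R r r = sub_mat M I J"
      by (rule eq_matI) (use len in \<open>auto simp: mat_delete_def replace_col_def sub_mat_def nth_append\<close>)
    then have cf: "cofactor ?R r r = det (sub_mat M I J)" by (simp add: cofactor_def)
    have "det ?R = (\<Sum>a<Suc r. ?R $$ (a, r) * cofactor ?R a r)"
      by (rule laplace_expansion_column[OF R]) simp
    also have "\<dots> = (\<Sum>a<Suc r. if a = r then y * det (sub_mat M I J) else 0)"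
    proof (rule sum.cong)
      fix a assume "a \<in> {..<Suc r}"
      then show "?R $$ (a, r) * cofactor ?R a r = (if a = r then y * det (sub_mat M I J) else 0)"
        using Ax[of a] A cf by (auto simp: replace_col_def)
    qed simp
    finally show ?thesis by simp
  qed
  ultimately show ?thesis by (simp add: y_def)
qed

section \<open>Error of the cross interpolation of a single matrix\<close>

text \<open>The factor \<open>V\<close> has \<open>r\<close> rows and \<open>r + 1\<close> columns,
  so it has a nonzero kernel vector, which \<open>X\<close> inherits. A zero row pads
  \<open>V\<close> to a singular square matrix, so that the determinant criterion applies.\<close>

lemma exists_kernel_vector:
  fixes X :: "nat \<Rightarrow> nat \<Rightarrow> 'a::field"
  assumes "\<And>p q. p < Suc r \<Longrightarrow> q < Suc r \<Longrightarrow> X p q = (\<Sum>a<r. U p a * V a q)"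
  obtains v where "\<exists>q<Suc r. v q \<noteq> 0" "\<And>p. p < Suc r \<Longrightarrow> (\<Sum>q<Suc r. X p q * v q) = 0"
proof -
  let ?V = "mat (Suc r) (Suc r) (\<lambda>(a, q). if a < r then V a q else 0)"
  have V: "?V \<in> carrier_mat (Suc r) (Suc r)" by simp
  have "det ?V = (\<Sum>q<Suc r. ?V $$ (r, q) * cofactor ?V r q)"
    by (rule laplace_expansion_row[OF V]) simp
  also have "\<dots> = 0" by (intro sum.neutral) auto
  finally have "det ?V = 0" .
  then obtain v where v: "v \<in> carrier_vec (Suc r)" "v \<noteq> 0\<^sub>v (Suc r)" "?V *\<^sub>v v = 0\<^sub>v (Suc r)"
    using det_0_iff_vec_prod_zero[OF V] by blast
  have ker: "(\<Sum>q<Suc r. V a q * v $ q) = 0" if "a < r" for a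
  proof -
    have "(?V *\<^sub>v v) $ a = (\<Sum>q<Suc r. V a q * v $ q)"
      using that v(1) by (simp add: scalar_prod_def lessThan_atLeast0 del: sum.lessThan_Suc sum.atLeast0_lessThan_Suc)
    then show ?thesis using v(3) that by simp
  qed
  show ?thesis
  proof
    show "\<exists>q<Suc r. v $ q \<noteq> 0"
      using v(1,2) by (metis carrier_vecD eq_vecI index_zero_vec)
    fix p assume "p < Suc r"
    then have "(\<Sum>q<Suc r. X p q * v $ q) = (\<Sum>q<Suc r. \<Sum>a<r. U p a * (V a q * v $ q))"
      by (intro sum.cong) (simp_all add: assms sum_distrib_right mult.assoc)
    also have "\<dots> = (\<Sum>a<r. U p a * (\<Sum>q<Suc r. V a q * v $ q))"
      by (subst sum.swap) (simp only: sum_distrib_left)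
    also have "\<dots> = 0" by (intro sum.neutral) (auto simp only: ker lessThan_iff mult_zero_right)
    finally show "(\<Sum>q<Suc r. X p q * v $ q) = 0" .
  qed
qed

text \<open>The common source of both error bounds. The estimate keeps the entries of the kernel
  vector, so that the Chebyshev case can pick the largest entry and the Frobenius case can sum
  squares.\<close>

lemma bordered_minor_bound:
  fixes M X :: "'i \<Rightarrow> 'j \<Rightarrow> 'a::real_normed_field"
  assumes mv: "is_maxvol R C M r I J" and nz: "det (sub_mat M I J) \<noteq> 0"
    and inv: "\<And>s s'. s < r \<Longrightarrow> s' < r \<Longrightarrow>
        (\<Sum>t<r. M (I ! s) (J ! t) * B t s') = (if s = s' then 1 else 0)"
    and ij: "i \<in> R" "j \<in> C"
    and X: "\<And>i j. i \<in> R \<Longrightarrow> j \<in> C \<Longrightarrow> X i j = (\<Sum>a<r. U i a * V a j)"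
  defines "y \<equiv> M i j - (\<Sum>t<r. \<Sum>s<r. M i (J ! t) * B t s * M (I ! s) j)"
  obtains v :: "nat \<Rightarrow> 'a" where "\<exists>q<Suc r. v q \<noteq> 0"
    and "\<And>p. p < Suc r \<Longrightarrow> norm y * norm (v p) \<le>
      (\<Sum>q<Suc r. \<Sum>l<Suc r. norm (M ((I @ [i]) ! q) ((J @ [j]) ! l) - X ((I @ [i]) ! q) ((J @ [j]) ! l))
        * norm (v l))"
proof -
  note len = is_maxvol_lengths[OF mv]
  let ?I = "I @ [i]" and ?J = "J @ [j]"
  let ?A = "sub_mat M ?I ?J" and ?D = "det (sub_mat M I J)"
  have A: "?A \<in> carrier_mat (Suc r) (Suc r)" using sub_mat_carrier[of M ?I ?J] len by simp
  have inR: "?I ! p \<in> R" "?J ! p \<in> C" if "p < Suc r" for p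
    using that len ij by (auto simp: nth_append less_Suc_eq subset_iff)
  have XUV: "X (?I ! p) (?J ! q) = (\<Sum>a<r. U (?I ! p) a * V a (?J ! q))"
    if "p < Suc r" "q < Suc r" for p q
    using X inR that by blast
  obtain v where v: "\<exists>q<Suc r. v q \<noteq> 0"
      "\<And>p. p < Suc r \<Longrightarrow> (\<Sum>q<Suc r. X (?I ! p) (?J ! q) * v q) = 0"
    using exists_kernel_vector[of r "\<lambda>p q. X (?I ! p) (?J ! q)" "\<lambda>p a. U (?I ! p) a" "\<lambda>a q. V a (?J ! q)",
      OF XUV] by blast
  \<comment> \<open>Deleting a row and a column of the bordered matrix leaves an \<open>r\<close> by
    \<open>r\<close> submatrix of \<open>M\<close>, to which maximality of the volume
    applies.\<close>
  have cof: "norm (cofactor ?A q p) \<le> norm ?D" if "q < Suc r" "p < Suc r" for p q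
  proof -
    have "norm (cofactor ?A q p) = norm (det (mat_delete ?A q p))"
      by (simp add: cofactor_def norm_mult norm_power)
    also have "\<dots> \<le> norm ?D"
      using that len ij mat_delete_sub_mat[of q ?I p ?J M]
      by (auto intro!: is_maxvol_le[OF mv] dest!: in_set_takeD in_set_dropD simp: subset_iff simp del: take_append drop_append)
    finally show ?thesis .
  qed
  show ?thesis
  proof
    show "\<exists>q<Suc r. v q \<noteq> 0" by fact
    fix p assume p: "p < Suc r"
    let ?E = "\<lambda>q l. M (?I ! q) (?J ! l) - X (?I ! q) (?J ! l)"
    \<comment> \<open>The adjugate times the matrix is the determinant times the identity.\<close>
    have "det ?A * v p = ((adj_mat ?A * ?A) *\<^sub>v vec (Suc r) v) $ p"
      using adj_mat(3)[OF A] p by (simp add: scalar_prod_def if_distrib if_distribR cong: if_cong)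
    also have "\<dots> = (adj_mat ?A *\<^sub>v (?A *\<^sub>v vec (Suc r) v)) $ p"
      using adj_mat(1)[OF A] A by (simp add: assoc_mult_mat_vec[of _ "Suc r" "Suc r" _ "Suc r"])
    also have "\<dots> = (\<Sum>q<Suc r. cofactor ?A q p * (?A *\<^sub>v vec (Suc r) v) $ q)"
      using p A len
      by (simp add: adj_mat_def scalar_prod_def lessThan_atLeast0 del: sum.lessThan_Suc sum.atLeast0_lessThan_Suc)
    \<comment> \<open>As \<open>v\<close> is in the kernel of the restricted \<open>X\<close>,
      subtracting \<open>X\<close> changes nothing and brings in the approximation error.\<close>
    also have "\<dots> = (\<Sum>q<Suc r. cofactor ?A q p * (\<Sum>l<Suc r. ?E q l * v l))"
    proof (rule sum.cong[OF refl])
      fix q assume "q \<in> {..<Suc r}"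
      then have "(?A *\<^sub>v vec (Suc r) v) $ q = (\<Sum>l<Suc r. M (?I ! q) (?J ! l) * v l)"
        using mult_sub_mat_vec[of q ?I M ?J v] len by (simp del: sum.lessThan_Suc)
      also have "\<dots> = (\<Sum>l<Suc r. ?E q l * v l)"
        using v(2)[of q] \<open>q \<in> _\<close>
        by (simp add: left_diff_distrib sum_subtractf del: sum.lessThan_Suc)
      finally show "cofactor ?A q p * (?A *\<^sub>v vec (Suc r) v) $ q
        = cofactor ?A q p * (\<Sum>l<Suc r. ?E q l * v l)" by simp
    qed
    finally have "norm (det ?A * v p) = norm (\<Sum>q<Suc r. cofactor ?A q p * (\<Sum>l<Suc r. ?E q l * v l))"
      by simp
    also have "\<dots> \<le> (\<Sum>q<Suc r. norm ?D * (\<Sum>l<Suc r. norm (?E q l) * norm (v l)))"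
    proof (rule sum_norm_le)
      fix q assume "q \<in> {..<Suc r}"
      moreover have "norm (\<Sum>l<Suc r. ?E q l * v l) \<le> (\<Sum>l<Suc r. norm (?E q l) * norm (v l))"
        by (rule sum_norm_le) (simp add: norm_mult)
      ultimately show "norm (cofactor ?A q p * (\<Sum>l<Suc r. ?E q l * v l))
          \<le> norm ?D * (\<Sum>l<Suc r. norm (?E q l) * norm (v l))"
        unfolding norm_mult using cof p by (intro mult_mono) auto
    qed
    also have "\<dots> = norm ?D * (\<Sum>q<Suc r. \<Sum>l<Suc r. norm (?E q l) * norm (v l))"
      by (simp only: sum_distrib_left)
    also have "det ?A = y * ?D"
      unfolding y_def by (rule det_sub_mat_bordered[OF len(1,2) inv])
    finally have "norm ?D * (norm y * norm (v p))
        \<le> norm ?D * (\<Sum>q<Suc r. \<Sum>l<Suc r. norm (?E q l) * norm (v l))"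
      by (simp only: norm_mult mult_ac)
    then show "norm y * norm (v p) \<le> (\<Sum>q<Suc r. \<Sum>l<Suc r. norm (?E q l) * norm (v l))"
      using nz by (simp only: mult_le_cancel_left) simp
  qed
qed

text \<open>Taking \<open>p\<close> with the largest \<open>norm (v p)\<close> bounds each of the
  \<open>(r + 1)\<^sup>2\<close> terms by \<open>E * norm (v p)\<close>, and the positive factor
  \<open>norm (v p)\<close> cancels.\<close>

lemma maxvol_cross_error_chebyshev:
  fixes M X :: "'i \<Rightarrow> 'j \<Rightarrow> 'a::real_normed_field"
  assumes mv: "is_maxvol R C M r I J" and nz: "det (sub_mat M I J) \<noteq> 0"
    and inv: "\<And>s s'. s < r \<Longrightarrow> s' < r \<Longrightarrow>
        (\<Sum>t<r. M (I ! s) (J ! t) * B t s') = (if s = s' then 1 else 0)"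
    and ij: "i \<in> R" "j \<in> C"
    and X: "\<And>i j. i \<in> R \<Longrightarrow> j \<in> C \<Longrightarrow> X i j = (\<Sum>a<r. U i a * V a j)"
    and E: "\<And>i j. i \<in> R \<Longrightarrow> j \<in> C \<Longrightarrow> norm (M i j - X i j) \<le> E"
  shows "norm (M i j - (\<Sum>t<r. \<Sum>s<r. M i (J ! t) * B t s * M (I ! s) j)) \<le> (real r + 1)\<^sup>2 * E"
    (is "norm ?y \<le> _")
proof -
  note len = is_maxvol_lengths[OF mv]
  obtain v :: "nat \<Rightarrow> 'a" where nzv: "\<exists>q<Suc r. v q \<noteq> 0"
    and v: "\<And>p. p < Suc r \<Longrightarrow> norm ?y * norm (v p) \<le>
      (\<Sum>q<Suc r. \<Sum>l<Suc r. norm (M ((I @ [i]) ! q) ((J @ [j]) ! l) - X ((I @ [i]) ! q) ((J @ [j]) ! l))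
        * norm (v l))"
    using bordered_minor_bound[of R C M r I J B i j X U V, OF mv nz inv ij X] by blast
  have inR: "(I @ [i]) ! p \<in> R" "(J @ [j]) ! p \<in> C" if "p < Suc r" for p
    using that len ij by (auto simp: nth_append less_Suc_eq subset_iff)
  have "Max ((\<lambda>l. norm (v l)) ` {..<Suc r}) \<in> (\<lambda>l. norm (v l)) ` {..<Suc r}"
    by (intro Max_in) auto
  then obtain p where p: "p < Suc r" "Max ((\<lambda>l. norm (v l)) ` {..<Suc r}) = norm (v p)" by auto
  have max: "norm (v l) \<le> norm (v p)" if "l < Suc r" for l
    unfolding p(2)[symmetric] by (rule Max_ge) (use that in auto)
  have E0: "0 \<le> E" using E[OF ij] norm_ge_zero order_trans by blast
  have "norm ?y * norm (v p) \<le> (\<Sum>q<Suc r. \<Sum>l<Suc r. E * norm (v p))"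
    by (rule order_trans[OF v[OF p(1)]], intro sum_mono mult_mono) (use E E0 max inR in auto)
  also have "\<dots> = ((real r + 1)\<^sup>2 * E) * norm (v p)"
    by (simp add: power2_eq_square algebra_simps)
  finally show ?thesis
  proof (rule mult_right_le_imp_le)
    show "0 < norm (v p)" using nzv max by (metis less_le_trans zero_less_norm_iff)
  qed
qed

text \<open>Cauchy-Schwarz over the pairs \<open>(q, l)\<close> gives one factor
  \<open>r + 1\<close>, because the squares of \<open>v\<close> are summed once for every
  \<open>q\<close>. Summing the squared bound over \<open>p\<close> gives the second one, and the
  square root of the product is \<open>r + 1\<close>.\<close>

lemma maxvol_cross_error_frobenius:
  fixes M X :: "'i \<Rightarrow> 'j \<Rightarrow> 'a::real_normed_field"
  assumes mv: "is_maxvol R C M r I J" and nz: "det (sub_mat M I J) \<noteq> 0"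
    and inv: "\<And>s s'. s < r \<Longrightarrow> s' < r \<Longrightarrow>
        (\<Sum>t<r. M (I ! s) (J ! t) * B t s') = (if s = s' then 1 else 0)"
    and ij: "i \<in> R" "j \<in> C"
    and X: "\<And>i j. i \<in> R \<Longrightarrow> j \<in> C \<Longrightarrow> X i j = (\<Sum>a<r. U i a * V a j)"
    and fin: "finite R" "finite C"
    and E: "(\<Sum>i\<in>R. \<Sum>j\<in>C. (norm (M i j - X i j))\<^sup>2) \<le> E\<^sup>2" "0 \<le> E"
  shows "norm (M i j - (\<Sum>t<r. \<Sum>s<r. M i (J ! t) * B t s * M (I ! s) j)) \<le> (real r + 1) * E"
    (is "norm ?y \<le> _")
proof (cases "?y = 0")
  case False
  note len = is_maxvol_lengths[OF mv]
  let ?I = "I @ [i]" and ?J = "J @ [j]"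
  let ?e = "\<lambda>q l. norm (M (?I ! q) (?J ! l) - X (?I ! q) (?J ! l))"
  obtain v :: "nat \<Rightarrow> 'a" where nzv: "\<exists>q<Suc r. v q \<noteq> 0"
    and v: "\<And>p. p < Suc r \<Longrightarrow> norm ?y * norm (v p) \<le> (\<Sum>q<Suc r. \<Sum>l<Suc r. ?e q l * norm (v l))"
    using bordered_minor_bound[of R C M r I J B i j X U V, OF mv nz inv ij X] by blast
  define N where "N = (\<Sum>l<Suc r. (norm (v l))\<^sup>2)"
  have N: "0 < N"
  proof -
    obtain q where "q < Suc r" "v q \<noteq> 0" using nzv by blast
    then show ?thesis unfolding N_def by (intro sum_pos2[of _ q]) auto
  qed
  \<comment> \<open>A nonzero error means a nonzero bordered minor, so no row or column is repeated.
    Hence the sum over positions counts each entry of the error matrix at most once.\<close>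
  have dist: "distinct ?I" "distinct ?J"
  proof -
    have "det (sub_mat M ?I ?J) \<noteq> 0"
      using det_sub_mat_bordered[OF len(1,2) inv, of i j] nz False by simp
    then show "distinct ?I" "distinct ?J"
      using det_sub_mat_eq_0_cols[of ?I ?J M] det_sub_mat_eq_0_rows[of ?I ?J M] len
      by (metis length_append_singleton)+
  qed
  have sub: "(\<Sum>q<Suc r. \<Sum>l<Suc r. (?e q l)\<^sup>2) \<le> E\<^sup>2"
  proof -
    have nthsum: "(\<Sum>q<Suc r. g (xs ! q)) = sum g (set xs)" if "distinct xs" "length xs = Suc r"
      for xs :: "'b list" and g :: "'b \<Rightarrow> real"
      using sum.reindex_bij_betw[OF bij_betw_nth[OF that(1) refl refl], of g] that(2) by simp
    have "(\<Sum>q<Suc r. \<Sum>l<Suc r. (?e q l)\<^sup>2) = (\<Sum>a\<in>set ?I. \<Sum>b\<in>set ?J. (norm (M a b - X a b))\<^sup>2)"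
    proof -
      have "(\<Sum>l<Suc r. (?e q l)\<^sup>2) = (\<Sum>b\<in>set ?J. (norm (M (?I ! q) b - X (?I ! q) b))\<^sup>2)" for q
        by (rule nthsum) (use dist len in auto)
      then show ?thesis
        using nthsum[of ?I "\<lambda>a. \<Sum>b\<in>set ?J. (norm (M a b - X a b))\<^sup>2"] dist len
        by (simp del: sum.lessThan_Suc set_append)
    qed
    also have "\<dots> \<le> (\<Sum>a\<in>R. \<Sum>b\<in>C. (norm (M a b - X a b))\<^sup>2)"
      by (rule order_trans[OF sum_mono[OF sum_mono2] sum_mono2])
         (use len ij fin in \<open>auto intro: sum_nonneg\<close>)
    finally show ?thesis using E(1) by linarith
  qed
  have key: "(norm ?y)\<^sup>2 * (norm (v p))\<^sup>2 \<le> E\<^sup>2 * ((real r + 1) * N)" if "p < Suc r" for p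
  proof -
    let ?P = "{..<Suc r} \<times> {..<Suc r}"
    let ?f = "\<lambda>(q, l). ?e q l" and ?g = "\<lambda>(q::nat, l). norm (v l)"
    have "(norm ?y * norm (v p)) \<le> (\<Sum>x\<in>?P. \<bar>?f x\<bar> * \<bar>?g x\<bar>)"
      using v[OF that] by (simp add: sum.cartesian_product case_prod_unfold del: sum.lessThan_Suc)
    also have "\<dots> \<le> L2_set ?f ?P * L2_set ?g ?P" by (rule L2_set_mult_ineq)
    finally have "(norm ?y * norm (v p))\<^sup>2 \<le> (L2_set ?f ?P * L2_set ?g ?P)\<^sup>2"
      by (intro power_mono) auto
    also have "\<dots> = (L2_set ?f ?P)\<^sup>2 * (L2_set ?g ?P)\<^sup>2" by (simp add: power_mult_distrib)
    also have "(L2_set ?f ?P)\<^sup>2 = (\<Sum>q<Suc r. \<Sum>l<Suc r. (?e q l)\<^sup>2)"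
      unfolding L2_set_def by (subst real_sqrt_pow2) (auto intro: sum_nonneg simp: sum.cartesian_product case_prod_unfold simp del: sum.lessThan_Suc)
    also have "(L2_set ?g ?P)\<^sup>2 = (\<Sum>q<Suc r. \<Sum>l<Suc r. (norm (v l))\<^sup>2)"
      unfolding L2_set_def sum.cartesian_product
      by (subst real_sqrt_pow2) (auto intro: sum_nonneg simp: case_prod_unfold simp del: sum.lessThan_Suc)
    also have "\<dots> = (\<Sum>q<Suc r. N)" by (simp only: N_def)
    also have "\<dots> = (real r + 1) * N" by simp
    also have "(\<Sum>q<Suc r. \<Sum>l<Suc r. (?e q l)\<^sup>2) * ((real r + 1) * N) \<le> E\<^sup>2 * ((real r + 1) * N)"
      using sub N by (intro mult_right_mono) auto
    finally show ?thesis by (simp only: power_mult_distrib)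
  qed
  have "(norm ?y)\<^sup>2 * N = (\<Sum>p<Suc r. (norm ?y)\<^sup>2 * (norm (v p))\<^sup>2)"
    unfolding N_def by (simp only: sum_distrib_left)
  also have "\<dots> \<le> (\<Sum>p<Suc r. E\<^sup>2 * ((real r + 1) * N))"
    by (rule sum_mono) (use key in auto)
  also have "\<dots> = ((real r + 1) * E)\<^sup>2 * N"
    by (simp add: power2_eq_square algebra_simps)
  finally have "(norm ?y)\<^sup>2 \<le> ((real r + 1) * E)\<^sup>2" using N by simp
  then show ?thesis by (rule power2_le_imp_le) (use E in auto)
qed (use E in simp)

section \<open>Multi-indices, tensor norms and unfoldings of tensor trains\<close>

lemma multi_indices_append:
  "i \<in> multi_indices ns \<Longrightarrow> j \<in> multi_indices ms \<Longrightarrow> i @ j \<in> multi_indices (ns @ ms)"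
  by (simp add: multi_indices_def list_all2_appendI)

lemma multi_indices_take: "i \<in> multi_indices ns \<Longrightarrow> take k i \<in> multi_indices (take k ns)"
  by (simp add: multi_indices_def)

lemma multi_indices_drop: "i \<in> multi_indices ns \<Longrightarrow> drop k i \<in> multi_indices (drop k ns)"
  by (simp add: multi_indices_def)

lemma length_multi_indices: "i \<in> multi_indices ns \<Longrightarrow> length i = length ns"
  by (auto simp: multi_indices_def dest: list_all2_lengthD)

lemma finite_multi_indices: "finite (multi_indices ns)"
proof (induction ns)
  case (Cons n ns)
  have "multi_indices (n # ns) \<subseteq> (\<lambda>(x, xs). x # xs) ` ({1..n} \<times> multi_indices ns)"
    by (auto simp: multi_indices_def list_all2_Cons2)
  then show ?case by (rule finite_subset) (use Cons in auto)
qed (simp add: multi_indices_def)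

lemma multi_indices_split:
  assumes "i \<in> multi_indices (take k ns)" "j \<in> multi_indices (drop k ns)"
  shows "i @ j \<in> multi_indices ns"
  using multi_indices_append[OF assms] by simp

text \<open>This transfers the Frobenius bound from the tensor to each unfolding.\<close>

lemma sum_multi_indices_split:
  assumes "k \<le> length ns"
  shows "(\<Sum>i\<in>multi_indices (take k ns). \<Sum>j\<in>multi_indices (drop k ns). f (i @ j))
    = sum f (multi_indices ns)"
proof -
  have "(\<Sum>i\<in>multi_indices (take k ns). \<Sum>j\<in>multi_indices (drop k ns). f (i @ j))
    = (\<Sum>(i, j)\<in>multi_indices (take k ns) \<times> multi_indices (drop k ns). f (i @ j))"
    by (rule sum.cartesian_product)
  also have "\<dots> = sum f (multi_indices ns)"
    using assms
    by (intro sum.reindex_bij_witness[of _ "\<lambda>i. (take k i, drop k i)" "\<lambda>(i, j). i @ j"])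
       (auto simp: multi_indices_split multi_indices_take multi_indices_drop dest: length_multi_indices)
  finally show ?thesis .
qed

lemma norm_le_chebyshev_norm: "i \<in> multi_indices ns \<Longrightarrow> norm (A i) \<le> chebyshev_norm ns A"
  unfolding chebyshev_norm_def by (rule Max_ge) (auto simp: finite_multi_indices)

lemma chebyshev_norm_le:
  assumes "multi_indices ns \<noteq> {}" "\<And>i. i \<in> multi_indices ns \<Longrightarrow> norm (A i) \<le> c"
  shows "chebyshev_norm ns A \<le> c"
  unfolding chebyshev_norm_def using assms by (subst Max_le_iff) (auto simp: finite_multi_indices)

text \<open>Cutting the train at \<open>k\<close> leaves two groups of factors that share only the
  summation index \<open>s k\<close>; its \<open>r k\<close> values give a factorization of the
  unfolding with inner dimension \<open>r k\<close>.\<close>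

lemma tt_unfolding_factorization:
  assumes tt: "has_tt_format ns r X" and k: "k < length ns"
  obtains U V where "\<And>i j. i \<in> multi_indices (take k ns) \<Longrightarrow> j \<in> multi_indices (drop k ns) \<Longrightarrow>
    X (i @ j) = (\<Sum>a<r k. U i a * V a j)"
proof -
  let ?d = "length ns"
  let ?R = "\<lambda>k. {..<r k}"
  obtain G where G: "\<And>i. i \<in> multi_indices ns \<Longrightarrow>
      X i = (\<Sum>s\<in>Pi\<^sub>E {0..?d} ?R. \<Prod>l=1..?d. G l (s (l - 1)) (i ! (l - 1)) (s l))"
    using tt unfolding has_tt_format_def by blast
  define F where "F i s = (\<Prod>l=1..k. G l (s (l - 1)) (i ! (l - 1)) (s l))" for i and s :: "nat \<Rightarrow> nat"
  \<comment> \<open>The parameter \<open>a\<close> stands for \<open>s k\<close>, which lies outside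
    the domain \<open>{Suc k..?d}\<close> of the right half. Positions in \<open>j\<close> are those
    in \<open>i @ j\<close> shifted by \<open>k\<close>.\<close>
  define H where "H a s j = (\<Prod>l=Suc k..?d. G l (if l = Suc k then a else s (l - 1)) (j ! (l - 1 - k)) (s l))"
    for a j and s :: "nat \<Rightarrow> nat"
  define U where "U i a = (\<Sum>s\<in>Pi\<^sub>E {0..k} ?R. if s k = a then F i s else 0)" for i a
  define V where "V a j = (\<Sum>s\<in>Pi\<^sub>E {Suc k..?d} ?R. H a s j)" for a j
  show ?thesis
  proof
    fix i j assume i: "i \<in> multi_indices (take k ns)" and j: "j \<in> multi_indices (drop k ns)"
    have len: "length i = k" using length_multi_indices[OF i] k by simp
    have fg: "(\<Prod>l=1..?d. G l (s (l - 1)) ((i @ j) ! (l - 1)) (s l)) = F i s * H (s k) s j" for s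
    proof -
      have "(\<Prod>l=1..?d. g l) = (\<Prod>l=1..k. g l) * (\<Prod>l=Suc k..?d. g l)" for g :: "nat \<Rightarrow> 'a"
        using prod.ub_add_nat[of 1 k g "?d - k"] k by simp
      then show ?thesis unfolding F_def H_def
        by (auto intro!: arg_cong2[of _ _ _ _ "(*)"] prod.cong simp: nth_append len)
    qed
    have F_cong: "F i s = F i s'" if "\<And>l. l \<le> k \<Longrightarrow> s l = s' l" for s s'
      unfolding F_def by (rule prod.cong) (use that in auto)
    have H_cong: "H a s j = H a s' j" if "\<And>l. k < l \<Longrightarrow> l \<le> ?d \<Longrightarrow> s l = s' l" for a s s'
      unfolding H_def by (rule prod.cong) (use that in auto)
    have "X (i @ j) = (\<Sum>s\<in>Pi\<^sub>E {0..?d} ?R. F i s * H (s k) s j)"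
      using G[OF multi_indices_split[OF i j]] fg by simp
    \<comment> \<open>A path through the train is a pair of its restrictions; the index at the cut
      belongs to the left half.\<close>
    also have "\<dots> = (\<Sum>(s, s')\<in>Pi\<^sub>E {0..k} ?R \<times> Pi\<^sub>E {Suc k..?d} ?R. F i s * H (s k) s' j)"
    proof (rule sum.reindex_bij_witness[of _ "\<lambda>(s, s') l. if l \<le> k then s l else s' l"
        "\<lambda>s. (restrict s {0..k}, restrict s {Suc k..?d})"], goal_cases)
      case (1 s)
      then show ?case by (auto simp: fun_eq_iff PiE_iff extensional_def)
    next
      case (2 s)
      then show ?case using k by (auto simp: PiE_iff)
    next
      case (3 x)
      then show ?case
        by (auto simp: fun_eq_iff PiE_iff extensional_def restrict_def)
    next
      case (4 x)
      then show ?case using k by (auto simp: PiE_iff extensional_def split: if_splits)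
    next
      case (5 s)
      have "F i (restrict s {0..k}) = F i s" by (rule F_cong) simp
      moreover have "H (s k) (restrict s {Suc k..?d}) j = H (s k) s j" by (rule H_cong) simp
      ultimately show ?case by simp
    qed
    also have "\<dots> = (\<Sum>s\<in>Pi\<^sub>E {0..k} ?R. F i s * V (s k) j)"
      unfolding V_def sum_distrib_left by (rule sum.cartesian_product[symmetric])
    also have "\<dots> = (\<Sum>s\<in>Pi\<^sub>E {0..k} ?R. \<Sum>a<r k. if s k = a then F i s * V a j else 0)"
      by (rule sum.cong) (auto simp: PiE_iff)
    also have "\<dots> = (\<Sum>a<r k. U i a * V a j)"
      unfolding U_def sum_distrib_right
      by (subst sum.swap) (auto intro!: sum.cong)
    finally show "X (i @ j) = (\<Sum>a<r k. U i a * V a j)" .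
  qed
qed

section \<open>The interpolation as a chain that can be cut anywhere\<close>

text \<open>
  \<open>cross_chain r I J B A i a n p q\<close> interpolates the piece with free indices \<open>i\<^bsub>a+1\<^esub>, \<dots>, i\<^bsub>a+n+1\<^esub>\<close>
  and \<open>n\<close> interior cuts, between a fixed left multi-index \<open>p\<close> and a fixed right multi-index \<open>q\<close>.
\<close>

primrec cross_chain ::
  "(nat \<Rightarrow> nat) \<Rightarrow> (nat \<Rightarrow> nat list list) \<Rightarrow> (nat \<Rightarrow> nat list list) \<Rightarrow>
   (nat \<Rightarrow> nat \<Rightarrow> nat \<Rightarrow> 'a::comm_ring_1) \<Rightarrow> 'a tensor \<Rightarrow> nat list \<Rightarrow>
   nat \<Rightarrow> nat \<Rightarrow> nat list \<Rightarrow> nat list \<Rightarrow> 'a" where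
  "cross_chain r I J B A i a 0 p q = A (p @ [i ! a] @ q)"
| "cross_chain r I J B A i a (Suc n) p q =
    (\<Sum>t<r (Suc (a + n)). \<Sum>s<r (Suc (a + n)).
      cross_chain r I J B A i a n p (J (Suc (a + n)) ! t) * B (Suc (a + n)) t s
        * A (I (Suc (a + n)) ! s @ [i ! Suc (a + n)] @ q))"

text \<open>The recursion only removes the last cut; associativity of the underlying matrix product
  allows any other. In the induction the last cut \<open>l\<close> is peeled off, the rest is split
  at \<open>k\<close>, and swapping sums regroups \<open>l\<close> with the right piece.\<close>

lemma cross_chain_split:
  assumes "k = Suc (a + m)"
  shows "cross_chain r I J B A i a (Suc (m + n)) p q =
    (\<Sum>t<r k. \<Sum>s<r k. cross_chain r I J B A i a m p (J k ! t) * B k t s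
      * cross_chain r I J B A i k n (I k ! s) q)"
proof (induction n arbitrary: q)
  case 0
  then show ?case using assms by simp
next
  case (Suc n)
  let ?c = "cross_chain r I J B A i"
  define l where "l = Suc (k + n)"
  have l: "Suc (a + Suc (m + n)) = l" using assms by (simp add: l_def)
  have "?c a (Suc (m + Suc n)) p q = (\<Sum>t'<r l. \<Sum>s'<r l.
      (\<Sum>t<r k. \<Sum>s<r k. ?c a m p (J k ! t) * B k t s * ?c k n (I k ! s) (J l ! t'))
       * B l t' s' * A (I l ! s' @ [i ! l] @ q))"
    unfolding Suc.IH[symmetric] by (simp only: add_Suc_right cross_chain.simps(2) l[simplified add_Suc_right])
  also have "\<dots> = (\<Sum>t'<r l. \<Sum>s'<r l. \<Sum>t<r k. \<Sum>s<r k.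
      ?c a m p (J k ! t) * B k t s * (?c k n (I k ! s) (J l ! t') * B l t' s' * A (I l ! s' @ [i ! l] @ q)))"
    by (simp add: sum_distrib_right mult.assoc)
  also have "\<dots> = (\<Sum>t'<r l. \<Sum>t<r k. \<Sum>s<r k. \<Sum>s'<r l.
      ?c a m p (J k ! t) * B k t s * (?c k n (I k ! s) (J l ! t') * B l t' s' * A (I l ! s' @ [i ! l] @ q)))"
    by (rule sum.cong[OF refl], subst sum.swap, rule sum.cong[OF refl], rule sum.swap)
  also have "\<dots> = (\<Sum>t<r k. \<Sum>s<r k. \<Sum>t'<r l. \<Sum>s'<r l.
      ?c a m p (J k ! t) * B k t s * (?c k n (I k ! s) (J l ! t') * B l t' s' * A (I l ! s' @ [i ! l] @ q)))"
    by (subst sum.swap, rule sum.cong[OF refl], rule sum.swap)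
  also have "\<dots> = (\<Sum>t<r k. \<Sum>s<r k. ?c a m p (J k ! t) * B k t s * ?c k (Suc n) (I k ! s) q)"
    by (simp add: l_def sum_distrib_left)
  finally show ?case .
qed

lemma sum_PiE_insert:
  assumes "x \<notin> S"
  shows "(\<Sum>f\<in>Pi\<^sub>E (insert x S) T. g f) = (\<Sum>y\<in>T x. \<Sum>f\<in>Pi\<^sub>E S T. g (f(x := y)))"
  unfolding PiE_insert_eq
  by (subst sum.reindex[OF inj_combinator[OF assms]])
     (simp add: sum.cartesian_product case_prod_unfold)

text \<open>Unrolls the recursion into the closed formula of \<open>tt_cross\<close>. Without cuts
  the first factor ends directly in \<open>q\<close>, hence the case distinction on
  \<open>n = 0\<close>.\<close>

lemma cross_chain_eq_sum_PiE:
  "cross_chain r I J B A i 0 n [] q =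
    (\<Sum>s\<in>Pi\<^sub>E {1..n} (\<lambda>k. {..<r k}). \<Sum>t\<in>Pi\<^sub>E {1..n} (\<lambda>k. {..<r k}).
      A ([i ! 0] @ (if n = 0 then q else J 1 ! t 1)) *
      (\<Prod>k=1..n. B k (t k) (s k) * A (I k ! s k @ [i ! k] @ (if k = n then q else J (k + 1) ! t (k + 1)))))"
proof (induction n arbitrary: q)
  case 0
  then show ?case by simp
next
  case (Suc n)
  let ?P = "Pi\<^sub>E {1..n} (\<lambda>k. {..<r k})" and ?k = "Suc n"
  let ?f = "\<lambda>n q s t. A ([i ! 0] @ (if n = 0 then q else J 1 ! t 1)) *
      (\<Prod>k=1..n. B k (t k) (s k) * A (I k ! s k @ [i ! k] @ (if k = n then q else J (k + 1) ! t (k + 1))))"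
  have ins: "{1..Suc n} = insert (Suc n) {1..n}" by auto
  \<comment> \<open>The new value \<open>z\<close> of \<open>t\<close> at \<open>?k\<close> appears
    in the old last factor, where \<open>J ?k ! z\<close> takes the place of the right end of the
    shorter chain.\<close>
  have step: "?f ?k q (s(?k := y)) (t(?k := z))
      = ?f n (J ?k ! z) s t * B ?k z y * A (I ?k ! y @ [i ! ?k] @ q)" for s t y z
  proof -
    have "(\<Prod>k=1..n. B k ((t(?k := z)) k) ((s(?k := y)) k)
          * A (I k ! (s(?k := y)) k @ [i ! k] @ (if k = ?k then q else J (k + 1) ! (t(?k := z)) (k + 1))))
        = (\<Prod>k=1..n. B k (t k) (s k)
          * A (I k ! s k @ [i ! k] @ (if k = n then J ?k ! z else J (k + 1) ! t (k + 1))))"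
      by (rule prod.cong) auto
    then show ?thesis by (simp add: prod.nat_ivl_Suc' mult_ac)
  qed
  have "cross_chain r I J B A i 0 ?k [] q
      = (\<Sum>z<r ?k. \<Sum>y<r ?k. \<Sum>s\<in>?P. \<Sum>t\<in>?P. ?f n (J ?k ! z) s t * B ?k z y * A (I ?k ! y @ [i ! ?k] @ q))"
    by (simp only: cross_chain.simps Suc.IH add_0 sum_distrib_right)
  also have "\<dots> = (\<Sum>z<r ?k. \<Sum>y<r ?k. \<Sum>s\<in>?P. \<Sum>t\<in>?P. ?f ?k q (s(?k := y)) (t(?k := z)))"
    by (simp only: step)
  also have "\<dots> = (\<Sum>y<r ?k. \<Sum>s\<in>?P. \<Sum>z<r ?k. \<Sum>t\<in>?P. ?f ?k q (s(?k := y)) (t(?k := z)))"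
    by (subst sum.swap, rule sum.cong[OF refl], rule sum.swap)
  also have "\<dots> = (\<Sum>s\<in>Pi\<^sub>E {1..?k} (\<lambda>k. {..<r k}). \<Sum>t\<in>Pi\<^sub>E {1..?k} (\<lambda>k. {..<r k}). ?f ?k q s t)"
    unfolding ins by (subst sum_PiE_insert, simp, subst sum_PiE_insert, simp, rule refl)
  finally show ?case .
qed

lemma tt_cross_eq_cross_chain:
  assumes "d \<ge> 2"
  shows "tt_cross d r I J A i
    = cross_chain r I J (\<lambda>k t s. inv_mat (cross_mat A I J k) $$ (t, s)) A i 0 (d - 1) [] []"
  unfolding tt_cross_def cross_chain_eq_sum_PiE using assms by simp

section \<open>Propagation of errors along the chain\<close>

text \<open>With \<open>e = u - u'\<close> and \<open>f = v - v'\<close> the difference is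
  \<open>eBv + uBf - eBf\<close>. The two linear terms cost \<open>n * \<epsilon>\<close> each by
  the coefficient bounds, and only the quadratic term sees the entries of \<open>B\<close>.\<close>

lemma bilinear_perturbation:
  fixes u u' v v' :: "nat \<Rightarrow> 'a::real_normed_field" and B :: "nat \<Rightarrow> nat \<Rightarrow> 'a"
  assumes u: "\<And>t. t < n \<Longrightarrow> norm (u t - u' t) \<le> \<epsilon>" and v: "\<And>s. s < n \<Longrightarrow> norm (v s - v' s) \<le> \<epsilon>"
    and uB: "\<And>s. s < n \<Longrightarrow> norm (\<Sum>t<n. u t * B t s) \<le> 1"
    and Bv: "\<And>t. t < n \<Longrightarrow> norm (\<Sum>s<n. B t s * v s) \<le> 1"
    and B: "\<And>t s. t < n \<Longrightarrow> s < n \<Longrightarrow> norm (B t s) \<le> \<beta>"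
    and \<epsilon>: "0 \<le> \<epsilon>"
  shows "norm ((\<Sum>t<n. \<Sum>s<n. u t * B t s * v s) - (\<Sum>t<n. \<Sum>s<n. u' t * B t s * v' s))
    \<le> (2 * real n + real n * real n * \<beta> * \<epsilon>) * \<epsilon>"
proof -
  let ?e = "\<lambda>t. u t - u' t" and ?f = "\<lambda>s. v s - v' s"
  have eBv: "norm (\<Sum>t<n. ?e t * (\<Sum>s<n. B t s * v s)) \<le> (\<Sum>t<n. \<epsilon> * 1)"
    by (intro sum_norm_le, unfold norm_mult, intro mult_mono) (simp_all add: u Bv \<epsilon>)
  have uBf: "norm (\<Sum>s<n. (\<Sum>t<n. u t * B t s) * ?f s) \<le> (\<Sum>s<n. 1 * \<epsilon>)"
    by (intro sum_norm_le, unfold norm_mult, intro mult_mono) (simp_all add: v uB)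
  have "norm (?e t * B t s * ?f s) \<le> \<epsilon> * \<beta> * \<epsilon>" if "t < n" "s < n" for t s
  proof -
    have "0 \<le> \<beta>" using order_trans[OF norm_ge_zero B[OF that]] .
    then show ?thesis
      unfolding norm_mult by (intro mult_mono) (simp_all add: that u v B \<epsilon>)
  qed
  then have eBf: "norm (\<Sum>t<n. \<Sum>s<n. ?e t * B t s * ?f s) \<le> (\<Sum>t<n. \<Sum>s<n. \<epsilon> * \<beta> * \<epsilon>)"
    by (intro sum_norm_le) simp
  have "(\<Sum>t<n. \<Sum>s<n. u t * B t s * v s) - (\<Sum>t<n. \<Sum>s<n. u' t * B t s * v' s)
    = (\<Sum>t<n. \<Sum>s<n. ?e t * (B t s * v s)) + (\<Sum>t<n. \<Sum>s<n. u t * B t s * ?f s)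
      - (\<Sum>t<n. \<Sum>s<n. ?e t * B t s * ?f s)"
    unfolding sum_subtractf[symmetric] sum.distrib[symmetric]
    by (intro sum.cong refl) (simp add: algebra_simps)
  also have "\<dots> = (\<Sum>t<n. ?e t * (\<Sum>s<n. B t s * v s)) + (\<Sum>s<n. (\<Sum>t<n. u t * B t s) * ?f s)
      - (\<Sum>t<n. \<Sum>s<n. ?e t * B t s * ?f s)"
    using sum.swap[of "\<lambda>t s. u t * B t s * ?f s" "{..<n}" "{..<n}"]
    by (simp only: sum_distrib_left sum_distrib_right)
  finally have "norm ((\<Sum>t<n. \<Sum>s<n. u t * B t s * v s) - (\<Sum>t<n. \<Sum>s<n. u' t * B t s * v' s))
    \<le> norm (\<Sum>t<n. ?e t * (\<Sum>s<n. B t s * v s))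
      + norm (\<Sum>s<n. (\<Sum>t<n. u t * B t s) * ?f s) + norm (\<Sum>t<n. \<Sum>s<n. ?e t * B t s * ?f s)"
    by (simp only:) (rule order_trans[OF norm_triangle_ineq4 add_right_mono[OF norm_triangle_ineq]])
  also have "\<dots> \<le> (\<Sum>t<n. \<epsilon> * 1) + (\<Sum>s<n. 1 * \<epsilon>) + (\<Sum>t<n. \<Sum>s<n. \<epsilon> * \<beta> * \<epsilon>)"
    by (intro add_mono eBv uBf eBf)
  also have "\<dots> = (2 * real n + real n * real n * \<beta> * \<epsilon>) * \<epsilon>"
    by (simp add: algebra_simps)
  finally show ?thesis .
qed

text \<open>Induction on the number \<open>l\<close> of halvings: \<open>\<rho>\<close> is the error
  of interpolating one unfolding, and each halving multiplies the bound by \<open>M\<close>. The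
  ends \<open>p\<close> and \<open>q\<close> vary, since the two halves end in interpolation indices
  of the middle cut.\<close>

lemma cross_chain_error:
  fixes A :: "'a::real_normed_field tensor"
  assumes i: "i \<in> multi_indices ns"
    and I: "\<And>k s. 1 \<le> k \<Longrightarrow> k < length ns \<Longrightarrow> s < r k \<Longrightarrow> I k ! s \<in> multi_indices (take k ns)"
    and J: "\<And>k t. 1 \<le> k \<Longrightarrow> k < length ns \<Longrightarrow> t < r k \<Longrightarrow> J k ! t \<in> multi_indices (drop k ns)"
    and row: "\<And>k x s. 1 \<le> k \<Longrightarrow> k < length ns \<Longrightarrow> x \<in> multi_indices (take k ns) \<Longrightarrow> s < r k \<Longrightarrow>
      norm (\<Sum>t<r k. A (x @ J k ! t) * B k t s) \<le> 1"
    and col: "\<And>k y t. 1 \<le> k \<Longrightarrow> k < length ns \<Longrightarrow> y \<in> multi_indices (drop k ns) \<Longrightarrow> t < r k \<Longrightarrow>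
      norm (\<Sum>s<r k. B k t s * A (I k ! s @ y)) \<le> 1"
    and skel: "\<And>k x y. 1 \<le> k \<Longrightarrow> k < length ns \<Longrightarrow> x \<in> multi_indices (take k ns) \<Longrightarrow>
      y \<in> multi_indices (drop k ns) \<Longrightarrow>
      norm (A (x @ y) - (\<Sum>t<r k. \<Sum>s<r k. A (x @ J k ! t) * B k t s * A (I k ! s @ y))) \<le> \<rho>"
    and B: "\<And>k t s. 1 \<le> k \<Longrightarrow> k < length ns \<Longrightarrow> t < r k \<Longrightarrow> s < r k \<Longrightarrow> norm (B k t s) \<le> \<beta> k"
    and M: "\<And>k. 1 \<le> k \<Longrightarrow> k < length ns \<Longrightarrow> 2 * real (r k) + real (r k) * real (r k) * \<beta> k * \<nu> \<le> M - 1"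
    and M1: "1 \<le> M" and \<rho>: "0 \<le> \<rho>"
  shows "n < 2 ^ l \<Longrightarrow> a + n < length ns \<Longrightarrow> p \<in> multi_indices (take a ns) \<Longrightarrow>
    q \<in> multi_indices (drop (Suc (a + n)) ns) \<Longrightarrow> (\<And>l'. l' < l \<Longrightarrow> M ^ l' * \<rho> \<le> \<nu>) \<Longrightarrow>
    norm (A (p @ take (Suc n) (drop a i) @ q) - cross_chain r I J B A i a n p q) \<le> M ^ l * \<rho>"
proof (induction l arbitrary: a n p q)
  case 0
  \<comment> \<open>Without interior cuts the chain is an entry of \<open>A\<close> itself, so the
    error is zero.\<close>
  have "take (Suc 0) (drop a i) = [i ! a]"
    using 0 length_multi_indices[OF i] by (simp add: take_Suc_conv_app_nth)
  then show ?case using 0 \<rho> by simp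
next
  case (Suc l)
  let ?c = "cross_chain r I J B A i"
  show ?case
  proof (cases n)
    case 0
    have "take (Suc 0) (drop a i) = [i ! a]"
      using Suc.prems 0 length_multi_indices[OF i] by (simp add: take_Suc_conv_app_nth)
    then show ?thesis using 0 \<rho> M1 by simp
  next
    case (Suc n0)
    \<comment> \<open>One cut joins the halves and the other \<open>n - 1\<close> are shared out
      evenly, so \<open>n < 2 ^ Suc l\<close> leaves fewer than \<open>2 ^ l\<close> on each
      side.\<close>
    define m n' where "m = n0 div 2" and "n' = n0 - m"
    define k where "k = Suc (a + m)"
    have n: "n = Suc (m + n')" using Suc by (simp add: m_def n'_def)
    have ml: "m < 2 ^ l" "n' < 2 ^ l"
      using Suc.prems(1) Suc by (auto simp: m_def n'_def)
    have k: "1 \<le> k" "k < length ns" "a + m < length ns" "k + n' < length ns"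
      using Suc.prems(2) n by (auto simp: k_def)
    define x where "x = p @ take (Suc m) (drop a i)"
    define y where "y = take (Suc n') (drop k i) @ q"
    define \<epsilon> where "\<epsilon> = M ^ l * \<rho>"
    have \<epsilon>: "0 \<le> \<epsilon>" "\<epsilon> \<le> \<nu>" "\<rho> \<le> \<epsilon>"
      using M1 \<rho> Suc.prems(5)[of l] mult_right_mono[of 1 "M ^ l" \<rho>] by (auto simp: \<epsilon>_def one_le_power)
    have x: "x \<in> multi_indices (take k ns)"
    proof -
      have "x \<in> multi_indices (take a ns @ take (Suc m) (drop a ns))"
        unfolding x_def by (intro multi_indices_append multi_indices_take multi_indices_drop Suc.prems i)
      then show ?thesis by (simp add: take_add[symmetric] k_def)
    qed
    have y: "y \<in> multi_indices (drop k ns)"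
    proof -
      have "y \<in> multi_indices (take (Suc n') (drop k ns) @ drop (Suc n') (drop k ns))"
        unfolding y_def using Suc.prems(4)
        by (intro multi_indices_append multi_indices_take multi_indices_drop i) (simp add: n k_def add_ac)
      then show ?thesis by (simp only: append_take_drop_id)
    qed
    have xy: "p @ take (Suc n) (drop a i) @ q = x @ y"
      using take_add[of "Suc m" "Suc n'" "drop a i"] by (simp add: x_def y_def n k_def add_ac)
    let ?u = "\<lambda>t. A (x @ J k ! t)" and ?v = "\<lambda>s. A (I k ! s @ y)"
    let ?u' = "\<lambda>t. ?c a m p (J k ! t)" and ?v' = "\<lambda>s. ?c k n' (I k ! s) q"
    have "norm ((\<Sum>t<r k. \<Sum>s<r k. ?u t * B k t s * ?v s) - (\<Sum>t<r k. \<Sum>s<r k. ?u' t * B k t s * ?v' s))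
        \<le> (2 * real (r k) + real (r k) * real (r k) * \<beta> k * \<epsilon>) * \<epsilon>"
    proof (rule bilinear_perturbation)
      show "norm (?u t - ?u' t) \<le> \<epsilon>" if "t < r k" for t
        using Suc.IH[of m a p "J k ! t"] ml k Suc.prems J[OF k(1,2) that]
        by (simp add: \<epsilon>_def x_def k_def)
      show "norm (?v s - ?v' s) \<le> \<epsilon>" if "s < r k" for s
        using Suc.IH[of n' k "I k ! s" q] ml k Suc.prems I[OF k(1,2) that]
        by (simp add: \<epsilon>_def y_def k_def n add_ac)
    qed (use row col B k x y \<epsilon> in auto)
    also have "\<dots> \<le> (M - 1) * \<epsilon>"
    proof (rule mult_right_mono)
      \<comment> \<open>The smallness assumption \<open>\<epsilon> \<le> \<nu>\<close> makes the
        quadratic term linear in \<open>\<epsilon>\<close>. The sign of \<open>\<beta> k\<close> is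
        known only when \<open>B k\<close> has an entry, hence the case
        \<open>r k = 0\<close>.\<close>
      have "real (r k) * real (r k) * \<beta> k * \<epsilon> \<le> real (r k) * real (r k) * \<beta> k * \<nu>"
      proof (cases "r k = 0")
        case False
        then have "0 \<le> \<beta> k" using B[OF k(1,2), of 0 0] norm_ge_zero[of "B k 0 0"] by linarith
        then show ?thesis using \<epsilon> by (intro mult_left_mono) auto
      qed simp
      then show "2 * real (r k) + real (r k) * real (r k) * \<beta> k * \<epsilon> \<le> M - 1"
        using M[OF k(1,2)] by linarith
    qed (use \<epsilon> in auto)
    finally have "norm (A (x @ y) - (\<Sum>t<r k. \<Sum>s<r k. ?u' t * B k t s * ?v' s)) \<le> \<rho> + (M - 1) * \<epsilon>"
      using norm_diff_triangle_le[OF skel[OF k(1,2) x y]] by blast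
    \<comment> \<open>Here \<open>\<rho> \<le> \<epsilon>\<close>, so the sum is at most
      \<open>M * \<epsilon>\<close>.\<close>
    also have "\<dots> \<le> M ^ Suc l * \<rho>"
      using \<epsilon>(3) by (simp add: \<epsilon>_def algebra_simps)
    finally show ?thesis
      unfolding xy[unfolded n] n cross_chain_split[OF k_def] .
  qed
qed

section \<open>Inverse matrices, their entries, and the number of halvings\<close>

text \<open>\<open>mat_inverse\<close> fails only on matrices that are not units of the matrix ring,
  and an invertible matrix is a unit; this justifies the use of \<open>the\<close> in
  \<open>inv_mat\<close>.\<close>

lemma inv_mat_props:
  fixes M :: "'a::field mat"
  assumes "invertible_mat M" "M \<in> carrier_mat n n"
  shows "M * inv_mat M = 1\<^sub>m n" "inv_mat M * M = 1\<^sub>m n" "inv_mat M \<in> carrier_mat n n" "det M \<noteq> 0"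
proof -
  obtain B where B: "M * B = 1\<^sub>m n" "B * M = 1\<^sub>m (dim_row B)"
    using assms unfolding invertible_mat_def inverts_mat_def by auto
  have "dim_col B = n" using arg_cong[OF B(1), of dim_col] by simp
  moreover have "dim_row B = n" using arg_cong[OF B(2), of dim_col] assms(2) by simp
  ultimately have Bc: "B \<in> carrier_mat n n" by auto
  then have "M \<in> Units (ring_mat TYPE('a) n ())"
    using B assms(2) unfolding Units_def ring_mat_def by auto
  then obtain C where "mat_inverse M = Some C"
    using mat_inverse(1)[OF assms(2), of "()"] by (cases "mat_inverse M") auto
  then show "M * inv_mat M = 1\<^sub>m n" "inv_mat M * M = 1\<^sub>m n" "inv_mat M \<in> carrier_mat n n"
    using mat_inverse(2)[OF assms(2)] by (auto simp: inv_mat_def)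
  have "det M * det B = 1" using det_mult[OF assms(2) Bc] B(1) by simp
  then show "det M \<noteq> 0" by auto
qed

lemma inv_sub_mat_sums:
  fixes M :: "'i \<Rightarrow> 'j \<Rightarrow> 'a::field"
  assumes "invertible_mat (sub_mat M I J)" "length I = n" "length J = n"
  defines "B \<equiv> inv_mat (sub_mat M I J)"
  shows "\<And>s s'. s < n \<Longrightarrow> s' < n \<Longrightarrow> (\<Sum>t<n. M (I ! s) (J ! t) * B $$ (t, s')) = (if s = s' then 1 else 0)"
    and "\<And>t t'. t < n \<Longrightarrow> t' < n \<Longrightarrow> (\<Sum>s<n. B $$ (t, s) * M (I ! s) (J ! t')) = (if t = t' then 1 else 0)"
proof -
  have S: "sub_mat M I J \<in> carrier_mat n n" using assms(2,3) sub_mat_carrier[of M I J] by simp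
  note B = inv_mat_props[OF assms(1) S, folded B_def]
  have entry: "sub_mat M I J $$ (s, t) = M (I ! s) (J ! t)" if "s < n" "t < n" for s t
    using that assms(2,3) by (simp add: sub_mat_def)
  fix a b assume ab: "a < n" "b < n"
  have "(sub_mat M I J * B) $$ (a, b) = (\<Sum>t<n. sub_mat M I J $$ (a, t) * B $$ (t, b))"
    using ab S B(3) by (simp add: times_mat_def scalar_prod_def lessThan_atLeast0)
  then show "(\<Sum>t<n. M (I ! a) (J ! t) * B $$ (t, b)) = (if a = b then 1 else 0)"
    using ab B(1) entry by simp
  have "(B * sub_mat M I J) $$ (a, b) = (\<Sum>t<n. B $$ (a, t) * sub_mat M I J $$ (t, b))"
    using ab S B(3) by (simp add: times_mat_def scalar_prod_def lessThan_atLeast0)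
  then show "(\<Sum>s<n. B $$ (a, s) * M (I ! s) (J ! b)) = (if a = b then 1 else 0)"
    using ab B(2) entry by simp
qed

lemma norm_le_mat_chebyshev_norm:
  assumes "i < dim_row M" "j < dim_col M"
  shows "norm (M $$ (i, j)) \<le> mat_chebyshev_norm M"
  unfolding mat_chebyshev_norm_def
proof (rule Max_ge)
  show "finite (norm ` elements_mat M)" by (simp add: elements_mat_def)
  show "norm (M $$ (i, j)) \<in> norm ` elements_mat M"
    by (intro imageI elements_matI[of M "dim_row M" "dim_col M"]) (use assms in auto)
qed

lemma le_two_power_ceiling_log:
  assumes "d \<ge> 1"
  shows "d \<le> 2 ^ nat \<lceil>log 2 (real d)\<rceil>"
proof -
  have "real d = 2 powr log 2 (real d)" using assms by simp
  also have "\<dots> \<le> 2 powr real (nat \<lceil>log 2 (real d)\<rceil>)"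
    by (intro powr_mono real_nat_ceiling_ge) auto
  also have "\<dots> = real (2 ^ nat \<lceil>log 2 (real d)\<rceil>)" by (simp add: powr_realpow)
  finally show ?thesis by (simp only: of_nat_le_iff)
qed

theorem theorem1:
  fixes d :: nat and ns :: "nat list"
    and A X :: "'a::real_normed_field tensor"
    and r :: "nat \<Rightarrow> nat" and I J :: "nat \<Rightarrow> nat list list"
    and E\<^sub>C E\<^sub>F \<kappa> :: real and rmax :: nat
  assumes "d \<ge> 2" and "length ns = d"
    and "\<exists>i\<in>multi_indices ns. A i \<noteq> 0"
    and "has_tt_format ns r X"
    and "chebyshev_norm ns (\<lambda>i. A i - X i) \<le> E\<^sub>C"
    and "frobenius_norm ns (\<lambda>i. A i - X i) \<le> E\<^sub>F"
    and "\<forall>k\<in>{1..d - 1}. is_maxvol (multi_indices (take k ns)) (multi_indices (drop k ns))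
           (unfolding_mat A) (r k) (I k) (J k)"
    and "\<forall>k\<in>{1..d - 1}. invertible_mat (cross_mat A I J k)"
    and "rmax = Max (r ` {1..d - 1})"
    and "\<kappa> = Max ((\<lambda>k. real (r k) * chebyshev_norm ns A
                        * mat_chebyshev_norm (inv_mat (cross_mat A I J k))) ` {1..d - 1})"
  shows
    "((2 * real rmax + \<kappa> * real rmax + 1) ^ nat \<lceil>log 2 (real d)\<rceil> * (real rmax + 1) * E\<^sub>F
        < chebyshev_norm ns A \<longrightarrow>
      chebyshev_norm ns (\<lambda>i. A i - tt_cross d r I J A i)
        \<le> (2 * real rmax + \<kappa> * real rmax + 1) ^ nat \<lceil>log 2 (real d)\<rceil> * (real rmax + 1) * E\<^sub>F) \<and>
     ((2 * real rmax + \<kappa> * real rmax + 1) ^ nat \<lceil>log 2 (real d)\<rceil> * (real rmax + 1)\<^sup>2 * E\<^sub>C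
        < chebyshev_norm ns A \<longrightarrow>
      chebyshev_norm ns (\<lambda>i. A i - tt_cross d r I J A i)
        \<le> (2 * real rmax + \<kappa> * real rmax + 1) ^ nat \<lceil>log 2 (real d)\<rceil> * (real rmax + 1)\<^sup>2 * E\<^sub>C)"
proof -
  note d = assms(1) and ns = assms(2)
  define M where "M = 2 * real rmax + \<kappa> * real rmax + 1"
  define L where "L = nat \<lceil>log 2 (real d)\<rceil>"
  define \<nu> where "\<nu> = chebyshev_norm ns A"
  define B where "B k t s = inv_mat (cross_mat A I J k) $$ (t, s)" for k t s
  define \<beta> where "\<beta> k = mat_chebyshev_norm (inv_mat (cross_mat A I J k))" for k
  let ?R = "\<lambda>k. multi_indices (take k ns)" and ?C = "\<lambda>k. multi_indices (drop k ns)"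
  have ne: "multi_indices ns \<noteq> {}" using assms(3) by blast
  have \<nu>: "0 \<le> \<nu>"
    using assms(3) norm_le_chebyshev_norm[of _ ns A] norm_ge_zero order_trans unfolding \<nu>_def by blast
  have mv: "is_maxvol (?R k) (?C k) (\<lambda>x y. A (x @ y)) (r k) (I k) (J k)"
    if "1 \<le> k" "k < d" for k
    using assms(7) that by (simp add: unfolding_mat_def)
  have cross: "cross_mat A I J k = sub_mat (\<lambda>x y. A (x @ y)) (I k) (J k)" for k
    by (simp add: cross_mat_def unfolding_mat_def)
  have inv: "invertible_mat (sub_mat (\<lambda>x y. A (x @ y)) (I k) (J k))" if "1 \<le> k" "k < d" for k
    using assms(8) that by (simp add: cross)
  note len = is_maxvol_lengths[OF mv]
  have carrier: "sub_mat (\<lambda>x y. A (x @ y)) (I k) (J k) \<in> carrier_mat (r k) (r k)" if "1 \<le> k" "k < d" for k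
    using sub_mat_carrier len[OF that] by metis
  note det = inv_mat_props(4)[OF inv carrier]
  have MB: "(\<Sum>t<r k. A (I k ! s @ J k ! t) * B k t s') = (if s = s' then 1 else 0)"
    if "1 \<le> k" "k < d" "s < r k" "s' < r k" for k s s'
    unfolding B_def cross by (rule inv_sub_mat_sums(1)) (use inv len that in auto)
  have BM: "(\<Sum>s<r k. B k t s * A (I k ! s @ J k ! t')) = (if t = t' then 1 else 0)"
    if "1 \<le> k" "k < d" "t < r k" "t' < r k" for k t t'
    unfolding B_def cross by (rule inv_sub_mat_sums(2)) (use inv len that in auto)
  have \<beta>: "norm (B k t s) \<le> \<beta> k" if "1 \<le> k" "k < d" "t < r k" "s < r k" for k t s
    unfolding B_def \<beta>_def using carrier_matD[OF inv_mat_props(3)[OF inv[OF that(1,2)] carrier[OF that(1,2)]]] that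
    by (intro norm_le_mat_chebyshev_norm) (simp_all add: cross)
  have rmax: "r k \<le> rmax" if "1 \<le> k" "k < d" for k
    unfolding assms(9) by (rule Max_ge) (use that in auto)
  have \<kappa>: "real (r k) * \<nu> * \<beta> k \<le> \<kappa>" if "1 \<le> k" "k < d" for k
    unfolding assms(10) \<nu>_def \<beta>_def by (rule Max_ge) (use that in auto)
  \<comment> \<open>If \<open>r 1 = 0\<close>, the norm of the empty inverse is a maximum over the
    empty set, but the factor \<open>r 1\<close> removes it.\<close>
  have \<kappa>0: "0 \<le> \<kappa>"
  proof (cases "r 1 = 0")
    case True
    then show ?thesis using \<kappa>[of 1] d by simp
  next
    case False
    then have "0 \<le> \<beta> 1" using \<beta>[of 1 0 0] d norm_ge_zero[of "B 1 0 0"] by linarith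
    then have "0 \<le> real (r 1) * \<nu> * \<beta> 1" using \<nu> by simp
    then show ?thesis using \<kappa>[of 1] d by linarith
  qed
  have M1: "1 \<le> M" using \<kappa>0 by (simp add: M_def)
  \<comment> \<open>The quadratic coefficient is \<open>r k\<close> times the quantity whose maximum
    is \<open>\<kappa>\<close>, which explains the term \<open>\<kappa> * real rmax\<close> in
    \<open>M\<close>.\<close>
  have step: "2 * real (r k) + real (r k) * real (r k) * \<beta> k * \<nu> \<le> M - 1" if "1 \<le> k" "k < d" for k
  proof -
    have "real (r k) * (real (r k) * \<nu> * \<beta> k) \<le> real rmax * \<kappa>"
      by (rule order_trans[OF mult_left_mono[OF \<kappa>[OF that]] mult_right_mono])
         (use rmax[OF that] \<kappa>0 in auto)
    then show ?thesis using rmax[OF that] by (simp add: M_def mult_ac)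
  qed
  \<comment> \<open>Both claims differ only in the bound \<open>\<rho>\<close> for a single
    unfolding.\<close>
  have main: "chebyshev_norm ns (\<lambda>i. A i - tt_cross d r I J A i) \<le> M ^ L * \<rho>"
    if skel: "\<And>k x y. 1 \<le> k \<Longrightarrow> k < d \<Longrightarrow> x \<in> ?R k \<Longrightarrow> y \<in> ?C k \<Longrightarrow>
        norm (A (x @ y) - (\<Sum>t<r k. \<Sum>s<r k. A (x @ J k ! t) * B k t s * A (I k ! s @ y))) \<le> \<rho>"
      and small: "M ^ L * \<rho> < \<nu>" and \<rho>: "0 \<le> \<rho>" for \<rho>
  proof (rule chebyshev_norm_le[OF ne])
    fix i assume i: "i \<in> multi_indices ns"
    have "norm (A ([] @ take (Suc (d - 1)) (drop 0 i) @ []) - cross_chain r I J B A i 0 (d - 1) [] [])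
        \<le> M ^ L * \<rho>"
    proof (rule cross_chain_error[where ns = ns and \<beta> = \<beta> and \<nu> = \<nu>, OF i])
      show "d - 1 < 2 ^ L" using le_two_power_ceiling_log[of d] d by (simp add: L_def)
      \<comment> \<open>As \<open>M \<ge> 1\<close>, the final smallness condition covers all
        earlier levels of the halving.\<close>
      show "M ^ l' * \<rho> \<le> \<nu>" if "l' < L" for l'
      proof -
        have "M ^ l' * \<rho> \<le> M ^ L * \<rho>"
          using M1 \<rho> that by (intro mult_right_mono power_increasing) auto
        then show ?thesis using small by simp
      qed
      show "I k ! s \<in> ?R k" if "1 \<le> k" "k < length ns" "s < r k" for k s
        using len[of k] that ns by (auto simp: subset_iff)
      show "J k ! t \<in> ?C k" if "1 \<le> k" "k < length ns" "t < r k" for k t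
        using len[of k] that ns by (auto simp: subset_iff)
      show "norm (\<Sum>t<r k. A (x @ J k ! t) * B k t s) \<le> 1"
        if "1 \<le> k" "k < length ns" "x \<in> ?R k" "s < r k" for k x s
        by (rule maxvol_coeff_row[OF mv[of k] det[of k]]) (use that ns BM in auto)
      show "norm (\<Sum>s<r k. B k t s * A (I k ! s @ y)) \<le> 1"
        if "1 \<le> k" "k < length ns" "y \<in> ?C k" "t < r k" for k y t
        by (rule maxvol_coeff_col[OF mv[of k] det[of k]]) (use that ns MB in auto)
    qed (use ns d skel \<beta> step M1 \<rho> in \<open>auto simp: multi_indices_def\<close>)
    moreover have "tt_cross d r I J A i = cross_chain r I J B A i 0 (d - 1) [] []"
      unfolding tt_cross_eq_cross_chain[OF d] B_def ..
    ultimately show "norm (A i - tt_cross d r I J A i) \<le> M ^ L * \<rho>"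
      using length_multi_indices[OF i] ns d by simp
  qed
  have EF: "(\<Sum>i\<in>multi_indices ns. (norm (A i - X i))\<^sup>2) \<le> E\<^sub>F\<^sup>2" "0 \<le> E\<^sub>F"
  proof -
    have nn: "0 \<le> (\<Sum>i\<in>multi_indices ns. (norm (A i - X i))\<^sup>2)" by (rule sum_nonneg) simp
    show "0 \<le> E\<^sub>F" using assms(6) real_sqrt_ge_zero[OF nn] unfolding frobenius_norm_def by linarith
    show "(\<Sum>i\<in>multi_indices ns. (norm (A i - X i))\<^sup>2) \<le> E\<^sub>F\<^sup>2"
      using assms(6) unfolding frobenius_norm_def by (rule sqrt_le_D)
  qed
  have EC: "norm (A i - X i) \<le> E\<^sub>C" if "i \<in> multi_indices ns" for i
    using norm_le_chebyshev_norm[OF that, of "\<lambda>i. A i - X i"] assms(5) by simp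
  have EC0: "0 \<le> E\<^sub>C" using assms(3) EC norm_ge_zero order_trans by blast
  \<comment> \<open>The tensor train format supplies the rank \<open>r k\<close> approximation of
    each unfolding that the matrix bound requires.\<close>
  have skelF: "norm (A (x @ y) - (\<Sum>t<r k. \<Sum>s<r k. A (x @ J k ! t) * B k t s * A (I k ! s @ y)))
      \<le> (real rmax + 1) * E\<^sub>F"
    if k: "1 \<le> k" "k < d" and xy: "x \<in> ?R k" "y \<in> ?C k" for k x y
  proof -
    obtain U V where UV: "\<And>i j. i \<in> ?R k \<Longrightarrow> j \<in> ?C k \<Longrightarrow> X (i @ j) = (\<Sum>a<r k. U i a * V a j)"
      using tt_unfolding_factorization[OF assms(4), of k] k ns by blast
    have "norm (A (x @ y) - (\<Sum>t<r k. \<Sum>s<r k. A (x @ J k ! t) * B k t s * A (I k ! s @ y)))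
        \<le> (real (r k) + 1) * E\<^sub>F"
    proof (rule maxvol_cross_error_frobenius[OF mv[OF k] det[OF k] MB[OF k] xy,
          where X = "\<lambda>x y. X (x @ y)" and U = U and V = V])
      show "(\<Sum>i\<in>?R k. \<Sum>j\<in>?C k. (norm (A (i @ j) - X (i @ j)))\<^sup>2) \<le> E\<^sub>F\<^sup>2"
        using EF(1) sum_multi_indices_split[of k ns "\<lambda>i. (norm (A i - X i))\<^sup>2"] k ns by simp
    qed (use UV EF(2) finite_multi_indices k in simp_all)
    also have "\<dots> \<le> (real rmax + 1) * E\<^sub>F"
      using rmax[OF k] EF(2) by (intro mult_right_mono) auto
    finally show ?thesis .
  qed
  have skelC: "norm (A (x @ y) - (\<Sum>t<r k. \<Sum>s<r k. A (x @ J k ! t) * B k t s * A (I k ! s @ y)))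
      \<le> (real rmax + 1)\<^sup>2 * E\<^sub>C"
    if k: "1 \<le> k" "k < d" and xy: "x \<in> ?R k" "y \<in> ?C k" for k x y
  proof -
    obtain U V where UV: "\<And>i j. i \<in> ?R k \<Longrightarrow> j \<in> ?C k \<Longrightarrow> X (i @ j) = (\<Sum>a<r k. U i a * V a j)"
      using tt_unfolding_factorization[OF assms(4), of k] k ns by blast
    have "norm (A (x @ y) - (\<Sum>t<r k. \<Sum>s<r k. A (x @ J k ! t) * B k t s * A (I k ! s @ y)))
        \<le> (real (r k) + 1)\<^sup>2 * E\<^sub>C"
    proof (rule maxvol_cross_error_chebyshev[OF mv[OF k] det[OF k] MB[OF k] xy,
          where X = "\<lambda>x y. X (x @ y)" and U = U and V = V])
      show "norm (A (i @ j) - X (i @ j)) \<le> E\<^sub>C" if "i \<in> ?R k" "j \<in> ?C k" for i j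
        using EC multi_indices_split that by blast
    qed (use UV k in simp_all)
    also have "\<dots> \<le> (real rmax + 1)\<^sup>2 * E\<^sub>C"
      using rmax[OF k] EC0 by (intro mult_right_mono power_mono) auto
    finally show ?thesis .
  qed
  \<comment> \<open>Reassociating the products isolates \<open>\<rho>\<close> as the factor after
    \<open>M ^ L\<close>.\<close>
  show ?thesis
    unfolding M_def[symmetric] L_def[symmetric] \<nu>_def[symmetric] mult.assoc
  proof (intro conjI impI)
    assume "M ^ L * ((real rmax + 1) * E\<^sub>F) < \<nu>"
    then show "chebyshev_norm ns (\<lambda>i. A i - tt_cross d r I J A i) \<le> M ^ L * ((real rmax + 1) * E\<^sub>F)"
      using EF(2) by (intro main skelF) simp_all
  next
    assume "M ^ L * ((real rmax + 1)\<^sup>2 * E\<^sub>C) < \<nu>"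
    then show "chebyshev_norm ns (\<lambda>i. A i - tt_cross d r I J A i) \<le> M ^ L * ((real rmax + 1)\<^sup>2 * E\<^sub>C)"
      using EC0 by (intro main skelC) simp_all
  qed
qed

end
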